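(* Let $G$ be a perfect group, let $d$ be a positive integer, and let $N\unlhd G$ be a normal subgroup such that $[G,{}_{d}N]$ is a proper subgroup of $\gamma_d(N)$. Then $S=\Gamma_1(G,N)$ is a subdirect subgroup of $G^{\mathcal{P}}\cong G^{2^d}$ which has a nilpotent quotient of class $d$.
   Context: Commutators are $[x,y]=x^{-1}y^{-1}xy$; for subgroups $K,L$, $[K,L]$ is the subgroup generated by all $[x,y]$, $x\in K$, $y\in L$; longer commutators are left associated. $\gamma_1(H)=H$ and $\gamma_{k+1}(H)=[\gamma_k(H),H]$. For $N\unlhd G$ put $[G,{}_{0}N]=G$ and $[G,{}_{m+1}N]=[[G,{}_{m}N],N]$ for $m\ge 0$. A group is perfect if $[G,G]=G$. A subgroup of a direct product is subdirect if it projects onto every factor. A group has nilpotency class $d\ge 1$ if it is nilpotent with $\gamma_{d+1}=1$ and $\gamma_d\neq 1$. Construction: let $[d]=\{1,\dots,d\}$ and let $\mathcal{P}$ be the power set of $[d]$, linearly ordered by short-lex: $A$ precedes $B$ iff $|A|<|B|$, or $|A|=|B|$ and $\min(A\setminus B)<\min(B\setminus A)$. For $A\subseteq[d]$ and $u\in G$ define $\Delta_A(u)\in G^{\mathcal{P}}$ by $\Delta_A(u)(B)=u$ if $A\subseteq B$, and $\Delta_A(u)(B)=1$ otherwise. For $K\subseteq G$ let $\Delta_A(K)=\{\Delta_A(u): u\in K\}$. For $k\in\{1,\dots,d+1\}$ define the subset of $G^{\mathcal{P}}$ $$\Gamma_k(G,N)=\prod_{|A|<k}\Delta_A\bigl([G,{}_{|A|}N]\bigr)\cdot\prod_{|A|\ge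 k}\Delta_A\bigl(\gamma_{|A|}(N)\bigr),$$ where the products are set products over $A\in\mathcal{P}$ and the factors are ordered by short-lex. *)

theory Defs
  imports "HOL-Algebra.Algebra"
begin

(* Commutators follow the convention [x,y] = x^-1 y^-1 x y; note that the library's
   derived_set uses x y x^-1 y^-1 instead. *)
definition commutator :: "('a, 'b) monoid_scheme \<Rightarrow> 'a \<Rightarrow> 'a \<Rightarrow> 'a" where
  "commutator G x y = inv\<^bsub>G\<^esub> x \<otimes>\<^bsub>G\<^esub> inv\<^bsub>G\<^esub> y \<otimes>\<^bsub>G\<^esub> x \<otimes>\<^bsub>G\<^esub> y"

definition comm_subgroup :: "('a, 'b) monoid_scheme \<Rightarrow> 'a set \<Rightarrow> 'a set \<Rightarrow> 'a set" where
  "comm_subgroup G K L = generate G {commutator G x y | x y. x \<in> K \<and> y \<in> L}"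

(* Indexed from 1 as usual; the value at 0 is junk and is never used below. *)
fun lower_central :: "('a, 'b) monoid_scheme \<Rightarrow> 'a set \<Rightarrow> nat \<Rightarrow> 'a set" where
  "lower_central G H 0 = H"
| "lower_central G H (Suc 0) = H"
| "lower_central G H (Suc (Suc k)) = comm_subgroup G (lower_central G H (Suc k)) H"

(* [G,_m N] *)
fun iter_comm :: "('a, 'b) monoid_scheme \<Rightarrow> 'a set \<Rightarrow> nat \<Rightarrow> 'a set" where
  "iter_comm G N 0 = carrier G"
| "iter_comm G N (Suc m) = comm_subgroup G (iter_comm G N m) N"

definition perfect_group :: "('a, 'b) monoid_scheme \<Rightarrow> bool" where
  "perfect_group G \<longleftrightarrow> group G \<and> comm_subgroup G (carrier G) (carrier G) = carrier G"

definition nilpotent_group :: "('a, 'b) monoid_scheme \<Rightarrow> bool" where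
  "nilpotent_group H \<longleftrightarrow>
     group H \<and> (\<exists>c. lower_central H (carrier H) (Suc c) = {\<one>\<^bsub>H\<^esub>})"

definition has_nilpotency_class :: "('a, 'b) monoid_scheme \<Rightarrow> nat \<Rightarrow> bool" where
  "has_nilpotency_class H d \<longleftrightarrow> d \<ge> 1 \<and> nilpotent_group H
     \<and> lower_central H (carrier H) (d + 1) = {\<one>\<^bsub>H\<^esub>}
     \<and> lower_central H (carrier H) d \<noteq> {\<one>\<^bsub>H\<^esub>}"

definition subdirect ::
  "'i set \<Rightarrow> ('i \<Rightarrow> ('a, 'b) monoid_scheme) \<Rightarrow> ('i \<Rightarrow> 'a) set \<Rightarrow> bool" where
  "subdirect I G S \<longleftrightarrow> subgroup S (product_group I G)
     \<and> (\<forall>i\<in>I. (\<lambda>f. f i) ` S = carrier (G i))"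

(* For A = B the second disjunct reads Min {} < Min {}, which is false. *)
definition shortlex :: "nat set \<Rightarrow> nat set \<Rightarrow> bool" where
  "shortlex A B \<longleftrightarrow>
     card A < card B \<or> (card A = card B \<and> Min (A - B) < Min (B - A))"

(* The subsets of {1..d} in increasing short-lex order; well defined by
   shortlex_list_ex1 below. *)
definition shortlex_list :: "nat \<Rightarrow> nat set list" where
  "shortlex_list d =
     (THE xs. set xs = Pow {1..d} \<and> distinct xs \<and> sorted_wrt shortlex xs)"

abbreviation cube_group :: "('a, 'b) monoid_scheme \<Rightarrow> nat \<Rightarrow> (nat set \<Rightarrow> 'a) monoid" where
  "cube_group G d \<equiv> product_group (Pow {1..d}) (\<lambda>_. G)"

definition Delta ::
  "('a, 'b) monoid_scheme \<Rightarrow> nat \<Rightarrow> nat set \<Rightarrow> 'a \<Rightarrow> (nat set \<Rightarrow> 'a)" where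
  "Delta G d A u = (\<lambda>B\<in>Pow {1..d}. if A \<subseteq> B then u else \<one>\<^bsub>G\<^esub>)"

definition set_prod_list :: "('a, 'b) monoid_scheme \<Rightarrow> 'a set list \<Rightarrow> 'a set" where
  "set_prod_list G Xs = foldr (set_mult G) Xs {\<one>\<^bsub>G\<^esub>}"

definition Gamma ::
  "('a, 'b) monoid_scheme \<Rightarrow> 'a set \<Rightarrow> nat \<Rightarrow> nat \<Rightarrow> (nat set \<Rightarrow> 'a) set" where
  "Gamma G N d k = set_mult (cube_group G d)
     (set_prod_list (cube_group G d)
       (map (\<lambda>A. Delta G d A ` iter_comm G N (card A))
          (filter (\<lambda>A. card A < k) (shortlex_list d))))
     (set_prod_list (cube_group G d)
       (map (\<lambda>A. Delta G d A ` lower_central G N (card A))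
          (filter (\<lambda>A. card A \<ge> k) (shortlex_list d))))"

lemma shortlex_same_card_iff:
  assumes "finite A" "finite B" "card A = card B"
  shows "shortlex A B \<longleftrightarrow> (\<exists>m. m \<in> A \<and> m \<notin> B \<and> (\<forall>j<m. j \<in> A \<longleftrightarrow> j \<in> B))"
proof (cases "A = B")
  case True
  then show ?thesis by (auto simp: shortlex_def)
next
  case False
  with assms have ne: "A - B \<noteq> {}" "B - A \<noteq> {}"
    by (metis Diff_eq_empty_iff card_subset_eq)+
  have fin: "finite (A - B)" "finite (B - A)" using assms by auto
  have eq: "shortlex A B \<longleftrightarrow> Min (A - B) < Min (B - A)"
    using assms by (simp add: shortlex_def)
  show ?thesis
  proof
    assume "shortlex A B"
    then have l: "Min (A - B) < Min (B - A)" using eq by simp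
    have m: "Min (A - B) \<in> A - B" using Min_in[OF fin(1) ne(1)] .
    have "j \<in> A \<longleftrightarrow> j \<in> B" if "j < Min (A - B)" for j
    proof -
      have "j \<notin> A - B" using that Min_le[OF fin(1), of j] by auto
      moreover have "j \<notin> B - A" using that l Min_le[OF fin(2), of j] by auto
      ultimately show ?thesis by blast
    qed
    then show "\<exists>m. m \<in> A \<and> m \<notin> B \<and> (\<forall>j<m. j \<in> A \<longleftrightarrow> j \<in> B)" using m by blast
  next
    assume "\<exists>m. m \<in> A \<and> m \<notin> B \<and> (\<forall>j<m. j \<in> A \<longleftrightarrow> j \<in> B)"
    then obtain m where m: "m \<in> A" "m \<notin> B" "\<forall>j<m. j \<in> A \<longleftrightarrow> j \<in> B" by blast
    have "Min (A - B) \<le> m" using m fin by simp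
    moreover have "m < Min (B - A)"
      using Min_in[OF fin(2) ne(2)] m by (metis DiffD1 DiffD2 linorder_neqE_nat)
    ultimately show "shortlex A B" using eq by simp
  qed
qed

lemma shortlex_irrefl: "\<not> shortlex A A"
  by (simp add: shortlex_def)

lemma shortlex_trans:
  assumes "finite A" "finite B" "finite C" "shortlex A B" "shortlex B C"
  shows "shortlex A C"
proof (cases "card A = card B \<and> card B = card C")
  case True
  obtain m where m: "m \<in> A" "m \<notin> B" "\<forall>j<m. j \<in> A \<longleftrightarrow> j \<in> B"
    using assms(4) True shortlex_same_card_iff[OF assms(1,2)] by auto
  obtain n where n: "n \<in> B" "n \<notin> C" "\<forall>j<n. j \<in> B \<longleftrightarrow> j \<in> C"
    using assms(5) True shortlex_same_card_iff[OF assms(2,3)] by auto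
  have "min m n \<in> A \<and> min m n \<notin> C \<and> (\<forall>j<min m n. j \<in> A \<longleftrightarrow> j \<in> C)"
    using m n by (cases m n rule: linorder_cases) auto
  moreover have "card A = card C" using True by simp
  ultimately show ?thesis using shortlex_same_card_iff[OF assms(1,3)] by blast
next
  case False
  then show ?thesis using assms(4,5) by (auto simp: shortlex_def)
qed

lemma shortlex_total:
  assumes "finite A" "finite B" "A \<noteq> B"
  shows "shortlex A B \<or> shortlex B A"
proof (cases "card A = card B")
  case True
  have "A - B \<noteq> {}" "B - A \<noteq> {}"
    using assms True by (metis Diff_eq_empty_iff card_subset_eq)+
  then have "Min (A - B) \<in> A - B" "Min (B - A) \<in> B - A"
    using assms Min_in[of "A - B"] Min_in[of "B - A"] by auto
  then have "Min (A - B) \<noteq> Min (B - A)" by (metis DiffD1 DiffD2)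
  then show ?thesis using True by (auto simp: shortlex_def)
next
  case False
  then show ?thesis by (auto simp: shortlex_def)
qed

lemma shortlex_list_exists:
  assumes "finite F" "\<And>A. A \<in> F \<Longrightarrow> finite A"
  shows "\<exists>xs. set xs = F \<and> distinct xs \<and> sorted_wrt shortlex xs"
  using assms
proof (induction F rule: finite_induct)
  case empty
  show ?case by (intro exI[of _ "[]"]) simp
next
  case (insert A F)
  then obtain xs where xs: "set xs = F" "distinct xs" "sorted_wrt shortlex xs" by auto
  let ?ys = "filter (\<lambda>B. shortlex B A) xs @ [A] @ filter (\<lambda>B. shortlex A B) xs"
  have finA: "finite A" and finF: "\<And>B. B \<in> F \<Longrightarrow> finite B" using insert.prems by auto
  have tot: "shortlex A B \<or> shortlex B A" if "B \<in> F" for B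
    using that insert.hyps(2) finA finF shortlex_total[of A B] by auto
  have "set ?ys = insert A F" using xs(1) tot by auto
  moreover have "sorted_wrt shortlex ?ys"
  proof -
    have "shortlex B C" if "B \<in> F" "C \<in> F" "shortlex B A" "shortlex A C" for B C
      using shortlex_trans[OF finF[OF that(1)] finA finF[OF that(2)]] that by simp
    then show ?thesis using xs by (auto simp: sorted_wrt_append sorted_wrt_filter)
  qed
  moreover have "distinct ?ys"
  proof -
    have "\<not> (shortlex B A \<and> shortlex A B)" if "B \<in> F" for B
      using shortlex_trans[OF finA finF[OF that] finA] shortlex_irrefl by blast
    then show ?thesis using xs shortlex_irrefl by auto
  qed
  ultimately show ?case by blast
qed

lemma shortlex_list_unique:
  assumes "\<And>A. A \<in> set xs \<Longrightarrow> finite A" "set xs = set ys"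
    "distinct xs" "distinct ys" "sorted_wrt shortlex xs" "sorted_wrt shortlex ys"
  shows "xs = ys"
  using assms
proof (induction xs arbitrary: ys)
  case Nil
  then show ?case by simp
next
  case (Cons x xs)
  then obtain y zs where ys: "ys = y # zs" by (cases ys) auto
  have "x = y"
  proof (rule ccontr)
    assume ne: "x \<noteq> y"
    then have "x \<in> set zs" "y \<in> set xs" using Cons.prems(2) ys by auto
    then have "shortlex y x" "shortlex x y" using Cons.prems(5,6) ys by auto
    moreover have "finite x" "finite y" using Cons.prems(1) \<open>y \<in> set xs\<close> by auto
    ultimately show False using shortlex_trans[of x y x] shortlex_irrefl by blast
  qed
  moreover have "xs = zs"
    using Cons.prems ys \<open>x = y\<close> by (intro Cons.IH) (auto simp: insert_ident)
  ultimately show ?case using ys by simp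
qed

lemma shortlex_list_ex1:
  "\<exists>!xs. set xs = Pow {1..d} \<and> distinct xs \<and> sorted_wrt shortlex xs"
proof -
  have fin: "finite A" if "A \<in> Pow {1..d}" for A :: "nat set"
    using that finite_subset by blast
  obtain xs where xs: "set xs = Pow {1..d}" "distinct xs" "sorted_wrt shortlex xs"
    using shortlex_list_exists[of "Pow {1..d}"] fin by auto
  show ?thesis
  proof (rule ex1I[of _ xs])
    show "set xs = Pow {1..d} \<and> distinct xs \<and> sorted_wrt shortlex xs" using xs by simp
  next
    fix ys assume ys: "set ys = Pow {1..d} \<and> distinct ys \<and> sorted_wrt shortlex ys"
    show "ys = xs"
      by (rule shortlex_list_unique) (use xs ys fin in auto)
  qed
qed

lemma shortlex_list_props:
  "set (shortlex_list d) = Pow {1..d}" "distinct (shortlex_list d)"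
  "sorted_wrt shortlex (shortlex_list d)"
  using theI'[OF shortlex_list_ex1[of d]] unfolding shortlex_list_def by auto

end

theory Submission
  imports Defs
begin

text \<open>All commutators of cube elements are governed by
  $[\Delta_A(u),\Delta_B(v)] = \Delta_{A\cup B}([u,v])$. Together with the three subgroups lemma,
  which gives $[[G,{}_mN],\gamma_k(N)] \le [G,{}_{m+k}N]$, this shows that each $\Gamma_k$ is a
  normal subgroup of $S=\Gamma_1$ and that $[\Gamma_k,S]\le\Gamma_{k+1}$. Hence
  $\gamma_{d+1}(S)\le\Gamma_{d+1}$. On the other hand $\gamma_d(S)$ contains
  $\Delta_{[d]}(\gamma_d(N))$ (take commutators of elements at singletons), while
  $\Delta_{[d]}(u)\in\Gamma_{d+1}$ forces $u\in[G,{}_dN]$. So $S/\Gamma_{d+1}$ has class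
  exactly $d$.\<close>


subsection \<open>Commutators modulo a normal subgroup\<close>

text \<open>An ordered set product is not visibly a subgroup and is awkward for commutators, while a
  generated subgroup hides its coordinates. Both descriptions of Gamma_k are therefore kept.
  Collecting shows that they agree (\<open>Gamma_eq_Delta_span\<close>). Normality and commutators
  are then tested on generators, and the top coordinate is read off from the product.

  The size of A \<union> B can be anything from max(|A|,|B|) to |A|+|B|, so the commutator estimates
  must hold for this whole range. Gamma_k and Gamma_{k+1} differ only at sets of size k, where
  gamma_k(N) shrinks to [G,_k N]; only there does Gamma_{k+1} ask for more than Gamma_k. The two
  series interleave, gamma_{n+1}(N) <= [G,_n N] <= gamma_n(N), which allows passing from one to the
  other at the cost of at most one index.\<close>

context group
begin

text \<open>Together with associativity and the rule for inverses of products, these cancellations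
  freely reduce words, so that \<open>simp\<close> with \<open>word_simps\<close> can check
  commutator identities.\<close>

lemma inv_mult_cancel_left:
  assumes "x \<in> carrier G" "y \<in> carrier G"
  shows "inv x \<otimes> (x \<otimes> y) = y" "x \<otimes> (inv x \<otimes> y) = y"
  using assms by (simp_all add: m_assoc [symmetric])

lemmas word_simps = commutator_def m_assoc inv_mult_group inv_mult_cancel_left

lemma commutator_closed [simp]:
  assumes "x \<in> carrier G" "y \<in> carrier G"
  shows "commutator G x y \<in> carrier G"
  using assms by (simp add: commutator_def)

lemma inv_commutator:
  assumes "x \<in> carrier G" "y \<in> carrier G"
  shows "inv (commutator G x y) = commutator G y x"
  using assms by (simp add: word_simps)

lemma conj_commutator:
  assumes "g \<in> carrier G" "x \<in> carrier G" "y \<in> carrier G"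
  shows "g \<otimes> commutator G x y \<otimes> inv g
    = commutator G (g \<otimes> x \<otimes> inv g) (g \<otimes> y \<otimes> inv g)"
  using assms by (simp add: word_simps)

end

context normal
begin

lemma commutator_swap:
  assumes "x \<in> carrier G" "y \<in> carrier G" "commutator G x y \<in> H"
  shows "commutator G y x \<in> H"
  using assms inv_commutator[of x y] m_inv_closed by metis

text \<open>For fixed y, the x with [x,y] in H form the preimage of the centraliser of the coset of
  y in G/H, hence a subgroup. With a^g = g^-1 a g, the identities behind the induction are [x^-1,y]
  = ([x,y]^-1)^(x^-1) and [xz,y] = [x,y]^z [z,y].\<close>

lemma commutator_generate_left:
  assumes S: "S \<subseteq> carrier G" and y: "y \<in> carrier G"
    and gens: "\<And>x. x \<in> S \<Longrightarrow> commutator G x y \<in> H"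
    and x: "x \<in> generate G S"
  shows "commutator G x y \<in> H"
  using x
proof (induction rule: generate.induct)
  case one
  then show ?case using y by (simp add: commutator_def)
next
  case (incl x)
  then show ?case by (rule gens)
next
  case (inv x)
  have x: "x \<in> carrier G" using inv S by blast
  have "commutator G (inv x) y = x \<otimes> inv (commutator G x y) \<otimes> inv x"
    using x y by (simp add: word_simps)
  then show ?case using gens[OF inv] x y by (simp add: inv_op_closed2)
next
  case (eng x z)
  have c: "x \<in> carrier G" "z \<in> carrier G"
    using eng generate_in_carrier[OF S] by blast+
  have "commutator G (x \<otimes> z) y
      = (inv z \<otimes> commutator G x y \<otimes> z) \<otimes> commutator G z y"
    using c y by (simp add: word_simps)
  then show ?case using eng c by (simp add: inv_op_closed1)
qed

text \<open>One argument at a time: \<open>commutator_generate_left\<close> treats x against each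
  generator of T, and inverting the commutator lets the same lemma treat y.\<close>

lemma commutator_generate:
  assumes "S \<subseteq> carrier G" "T \<subseteq> carrier G"
    and "\<And>x y. \<lbrakk>x \<in> S; y \<in> T\<rbrakk> \<Longrightarrow> commutator G x y \<in> H"
    and "x \<in> generate G S" "y \<in> generate G T"
  shows "commutator G x y \<in> H"
proof -
  have xc: "x \<in> carrier G" and yc: "y \<in> carrier G"
    using assms generate_in_carrier by blast+
  have "commutator G x t \<in> H" if "t \<in> T" for t
    using commutator_generate_left[OF assms(1) _ _ assms(4)] assms(2,3) that by blast
  then have "commutator G t x \<in> H" if "t \<in> T" for t
    using commutator_swap that assms(2) xc by blast
  then have "commutator G y x \<in> H"
    using commutator_generate_left[OF assms(2) xc _ assms(5)] by blast
  then show ?thesis using commutator_swap xc yc by blast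
qed

lemma commutator_generate_right:
  assumes "T \<subseteq> carrier G" "x \<in> carrier G"
    and "\<And>y. y \<in> T \<Longrightarrow> commutator G x y \<in> H" and "y \<in> generate G T"
  shows "commutator G x y \<in> H"
  using commutator_generate[of "{x}" T x y] assms generate.incl[of x "{x}" G] by auto

text \<open>This is the Hall-Witt identity with z replaced by its inverse: the product of
  \<open>?a\<close>, \<open>?b\<close>, \<open>?c\<close> is 1. Solving for the inverse of
  \<open>?b\<close> expresses [x,[y,z]] as a conjugate of the product of \<open>?c\<close> and
  \<open>?a\<close>.\<close>

lemma three_subgroups:
  assumes carr: "x \<in> carrier G" "y \<in> carrier G" "z \<in> carrier G"
    and "commutator G (commutator G x (inv y)) (inv z) \<in> H"
    and "commutator G (commutator G (inv z) (inv x)) y \<in> H"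
  shows "commutator G x (commutator G y z) \<in> H"
proof -
  let ?a = "inv y \<otimes> commutator G (commutator G x (inv y)) (inv z) \<otimes> y"
  let ?b = "z \<otimes> commutator G (commutator G y z) x \<otimes> inv z"
  let ?c = "inv x \<otimes> commutator G (commutator G (inv z) (inv x)) y \<otimes> x"
  have H: "?a \<in> H" "?c \<in> H" using assms by (simp_all add: inv_op_closed1)
  have "commutator G x (commutator G y z) = inv z \<otimes> (?c \<otimes> ?a) \<otimes> z"
    using carr by (simp add: word_simps)
  then show ?thesis using H carr by (simp add: inv_op_closed1)
qed

end

subsection \<open>Central series\<close>

context group
begin

lemma commutator_in_comm_subgroup:
  "\<lbrakk>x \<in> K; y \<in> L\<rbrakk> \<Longrightarrow> commutator G x y \<in> comm_subgroup G K L"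
  unfolding comm_subgroup_def by (rule generate.incl) blast

lemma comm_subgroup_subset:
  assumes "subgroup H G" "\<And>x y. \<lbrakk>x \<in> K; y \<in> L\<rbrakk> \<Longrightarrow> commutator G x y \<in> H"
  shows "comm_subgroup G K L \<subseteq> H"
  unfolding comm_subgroup_def using assms by (intro generate_subgroup_incl) auto

lemma comm_subgroup_normal:
  assumes "K \<lhd> G" "L \<lhd> G"
  shows "comm_subgroup G K L \<lhd> G"
  unfolding comm_subgroup_def
proof (rule normal_generateI)
  have sub: "K \<subseteq> carrier G" "L \<subseteq> carrier G"
    using assms normal_invE(1) subgroup.subset by blast+
  then show "{commutator G x y |x y. x \<in> K \<and> y \<in> L} \<subseteq> carrier G"
    using commutator_closed by blast
  fix h g
  assume "h \<in> {commutator G x y |x y. x \<in> K \<and> y \<in> L}" and g: "g \<in> carrier G"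
  then obtain x y where h: "h = commutator G x y" "x \<in> K" "y \<in> L" by blast
  then have "x \<in> carrier G" "y \<in> carrier G" using sub by auto
  then have "g \<otimes> h \<otimes> inv g
      = commutator G (g \<otimes> x \<otimes> inv g) (g \<otimes> y \<otimes> inv g)"
    using h g conj_commutator by simp
  moreover have "g \<otimes> x \<otimes> inv g \<in> K" "g \<otimes> y \<otimes> inv g \<in> L"
    using h g assms normal_invE(2) by auto
  ultimately show "g \<otimes> h \<otimes> inv g \<in> {commutator G x y |x y. x \<in> K \<and> y \<in> L}"
    by blast
qed

lemma normal_commutator_left:
  assumes "K \<lhd> G" "x \<in> K" "y \<in> carrier G"
  shows "commutator G x y \<in> K"
proof -
  interpret normal K G by fact
  have "x \<in> carrier G" using assms(2) subset by blast
  then have "commutator G x y = inv x \<otimes> (inv y \<otimes> x \<otimes> y)"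
    using assms by (simp add: word_simps)
  then show ?thesis using assms by (simp add: inv_op_closed1)
qed

lemma normal_commutator_right:
  assumes "K \<lhd> G" "x \<in> carrier G" "y \<in> K"
  shows "commutator G x y \<in> K"
proof -
  interpret normal K G by fact
  show ?thesis
    using normal_commutator_left[OF assms(1,3,2)] commutator_swap assms subset by blast
qed

lemma comm_subgroup_subset_left:
  assumes "K \<lhd> G" "L \<subseteq> carrier G"
  shows "comm_subgroup G K L \<subseteq> K"
  using assms normal_commutator_left normal_invE(1)
  by (intro comm_subgroup_subset) auto

lemma lower_central_Suc:
  "k \<ge> 1 \<Longrightarrow> lower_central G N (Suc k) = comm_subgroup G (lower_central G N k) N"
  by (cases k) auto

lemma lower_central_normal: "N \<lhd> G \<Longrightarrow> lower_central G N k \<lhd> G"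
  by (induction k rule: induct_nat_012) (simp_all add: comm_subgroup_normal)

lemma iter_comm_normal: "N \<lhd> G \<Longrightarrow> iter_comm G N k \<lhd> G"
proof (induction k)
  case 0
  show ?case by (simp add: normal_inv_iff subgroup_self)
qed (simp add: comm_subgroup_normal)

lemma iter_comm_antimono:
  assumes "N \<lhd> G" "m \<le> n"
  shows "iter_comm G N n \<subseteq> iter_comm G N m"
  using assms(2)
proof (induction n rule: dec_induct)
  case (step n)
  then show ?case
    using comm_subgroup_subset_left[OF iter_comm_normal[OF assms(1), of n], of N]
      normal_invE(1)[OF assms(1)] subgroup.subset by fastforce
qed simp

lemma lower_central_antimono:
  assumes "N \<lhd> G" "1 \<le> m" "m \<le> n"
  shows "lower_central G N n \<subseteq> lower_central G N m"
  using assms(3)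
proof (induction n rule: dec_induct)
  case (step n)
  then show ?case
    using comm_subgroup_subset_left[OF lower_central_normal[OF assms(1), of n], of N]
      normal_invE(1)[OF assms(1)] subgroup.subset lower_central_Suc[of n N] assms(2)
    by fastforce
qed simp

lemma comm_subgroup_mono:
  "\<lbrakk>K \<subseteq> K'; L \<subseteq> L'\<rbrakk> \<Longrightarrow> comm_subgroup G K L \<subseteq> comm_subgroup G K' L'"
  unfolding comm_subgroup_def by (rule mono_generate) blast

text \<open>Both series iterate [-,N], so N <= G propagates by monotonicity. The next lemma starts
  in the same way from [G,N] <= N, and together they interleave the series.\<close>

lemma lower_central_subset_iter_comm:
  assumes "N \<subseteq> carrier G"
  shows "lower_central G N (Suc k) \<subseteq> iter_comm G N k"
  using assms by (induction k) (simp_all add: comm_subgroup_mono)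

lemma iter_comm_subset_lower_central:
  assumes "N \<lhd> G" "k \<ge> 1"
  shows "iter_comm G N k \<subseteq> lower_central G N k"
  using assms(2)
proof (induction k rule: dec_induct)
  case base
  show ?case
    using comm_subgroup_subset[OF normal_invE(1)[OF assms(1)], of "carrier G" N]
      normal_commutator_right[OF assms(1)] by auto
next
  case (step k)
  then show ?case using comm_subgroup_mono[OF step.IH order_refl] lower_central_Suc by auto
qed

text \<open>Abstracting the chain lets one induction serve both \<open>iter_comm\<close> and the
  lower central series. By the three subgroups argument, [P m, [gamma_k(N), N]] is controlled by
  [[P m, gamma_k(N)], N] and [[N, P m], gamma_k(N)].\<close>

lemma commutator_descending_chain:
  fixes P :: "nat \<Rightarrow> 'a set"
  assumes N: "N \<lhd> G" and P: "\<And>m. P m \<lhd> G"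
    and chain: "\<And>m x y. \<lbrakk>x \<in> P m; y \<in> N\<rbrakk> \<Longrightarrow> commutator G x y \<in> P (Suc m)"
    and "k \<ge> 1" "x \<in> P m" "y \<in> lower_central G N k"
  shows "commutator G x y \<in> P (m + k)"
  using assms(4-)
proof (induction k arbitrary: m x y rule: dec_induct)
  case base
  then show ?case using chain by simp
next
  case (step k)
  interpret M: normal "P (m + Suc k)" G by (rule P)
  interpret L: normal "lower_central G N k" G by (rule lower_central_normal[OF N])
  interpret N: normal N G by (rule N)
  interpret P: normal "P m" G by (rule P)
  interpret P': normal "P (Suc m)" G by (rule P)
  let ?T = "{commutator G y n | y n. y \<in> lower_central G N k \<and> n \<in> N}"
  have xc: "x \<in> carrier G" using step.prems(1) P.subset by blast
  have gen: "commutator G x (commutator G y n) \<in> P (m + Suc k)"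
    if "y \<in> lower_central G N k" "n \<in> N" for y n
  proof (rule M.three_subgroups)
    show "x \<in> carrier G" "y \<in> carrier G" "n \<in> carrier G" using that xc by auto
    show "commutator G (commutator G x (inv y)) (inv n) \<in> P (m + Suc k)"
      using chain[OF step.IH[of x m "inv y"], of "inv n"] step.prems that by simp
    \<comment> \<open>Here N acts first and leads to \<open>P (Suc m)\<close>, so the induction
      hypothesis is used at \<open>Suc m\<close>; this is why m is generalised.\<close>
    have "commutator G (inv x) (inv n) \<in> P (Suc m)" using chain step.prems that by simp
    then have "commutator G (inv n) (inv x) \<in> P (Suc m)"
      using P'.commutator_swap that xc by simp
    then show "commutator G (commutator G (inv n) (inv x)) y \<in> P (m + Suc k)"
      using step.IH[of _ "Suc m" y] that by simp
  qed
  show ?case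
  proof (rule M.commutator_generate_right)
    show "?T \<subseteq> carrier G" using commutator_closed L.subset N.subset by blast
    show "y \<in> generate G ?T"
      using step.prems step.hyps by (simp add: lower_central_Suc comm_subgroup_def)
    show "commutator G x t \<in> P (m + Suc k)" if "t \<in> ?T" for t
      using that gen by blast
  qed (rule xc)
qed

lemma commutator_iter_comm_lower_central:
  assumes "N \<lhd> G" "k \<ge> 1" "x \<in> iter_comm G N m" "y \<in> lower_central G N k"
  shows "commutator G x y \<in> iter_comm G N (m + k)"
  using commutator_descending_chain[of N "iter_comm G N", OF assms(1) _ _ assms(2-)]
  by (simp add: assms(1) iter_comm_normal commutator_in_comm_subgroup)

lemma commutator_lower_central:
  assumes N: "N \<lhd> G" and "m \<ge> 1" "k \<ge> 1" "x \<in> lower_central G N m" "y \<in> lower_central G N k"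
  shows "commutator G x y \<in> lower_central G N (m + k)"
proof -
  \<comment> \<open>With the index shifted by one, every link of the chain is the defining
    recursion, including the first.\<close>
  obtain m' where "m = Suc m'" using assms(2) by (cases m) auto
  then show ?thesis
    using commutator_descending_chain[of N "\<lambda>m. lower_central G N (Suc m)" k x m' y]
      assms lower_central_normal[OF N] commutator_in_comm_subgroup by auto
qed

end

section \<open>Homomorphic images, quotients and nilpotency class\<close>

lemma (in group_hom) hom_commutator:
  assumes "x \<in> carrier G" "y \<in> carrier G"
  shows "h (commutator G x y) = commutator H (h x) (h y)"
  using assms by (simp add: commutator_def)

lemma (in group_hom) hom_comm_subgroup:
  assumes "K \<subseteq> carrier G" "L \<subseteq> carrier G"
  shows "h ` comm_subgroup G K L = comm_subgroup H (h ` K) (h ` L)"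
proof -
  have "{commutator H x y |x y. x \<in> h ` K \<and> y \<in> h ` L}
      = h ` {commutator G x y |x y. x \<in> K \<and> y \<in> L}" (is "_ = h ` ?X")
  proof -
    have "commutator H (h x) (h y) = h (commutator G x y)" if "x \<in> K" "y \<in> L" for x y
      using that assms by (metis hom_commutator subsetD)
    then show ?thesis by (force simp: image_iff)
  qed
  moreover have "?X \<subseteq> carrier G" using assms G.commutator_closed by blast
  ultimately show ?thesis using generate_img[of ?X] by (simp add: comm_subgroup_def)
qed

lemma (in group) lower_central_subset_carrier:
  assumes "K \<subseteq> carrier G"
  shows "lower_central G K k \<subseteq> carrier G"
proof (induction k rule: induct_nat_012)
  case (ge2 k)
  then show ?case
    using assms commutator_closed unfolding lower_central.simps
    by (intro comm_subgroup_subset subgroup_self) blast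
qed (simp_all add: assms)

lemma (in group_hom) hom_lower_central:
  assumes "K \<subseteq> carrier G"
  shows "h ` lower_central G K k = lower_central H (h ` K) k"
  by (induction k rule: induct_nat_012)
    (simp_all add: hom_comm_subgroup G.lower_central_subset_carrier assms)

text \<open>The quotient map carries gamma_k(G) onto gamma_k(G/H), which is therefore trivial iff
  gamma_k(G) <= H.\<close>

lemma (in normal) has_nilpotency_class_Mod:
  assumes "d \<ge> 1" and le: "lower_central G (carrier G) (d + 1) \<subseteq> H"
    and nle: "\<not> lower_central G (carrier G) d \<subseteq> H"
  shows "has_nilpotency_class (G Mod H) d"
proof -
  interpret Q: group "G Mod H" by (rule factorgroup_is_group)
  interpret q: group_hom G "G Mod H" "\<lambda>x. H #> x"
    by unfold_locales (rule r_coset_hom_Mod)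
  have im: "lower_central (G Mod H) (carrier (G Mod H)) k
      = (\<lambda>x. H #> x) ` lower_central G (carrier G) k" for k
    using q.hom_lower_central[of "carrier G" k] by (simp add: carrier_FactGroup)
  have one: "(\<lambda>x. H #> x) ` Y = {H} \<longleftrightarrow> Y \<noteq> {} \<and> Y \<subseteq> H" if "Y \<subseteq> carrier G" for Y
  proof -
    have "(\<lambda>x. H #> x) ` Y = {H} \<longleftrightarrow> Y \<noteq> {} \<and> (\<forall>y\<in>Y. H #> y = H)" by auto
    moreover have "H #> y = H \<longleftrightarrow> y \<in> H" if "y \<in> Y" for y
      using that \<open>Y \<subseteq> carrier G\<close> coset_join1 coset_join2 is_subgroup by blast
    ultimately show ?thesis by (simp add: subset_eq)
  qed
  have carr: "lower_central G (carrier G) k \<subseteq> carrier G" for k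
    by (simp add: lower_central_subset_carrier)
  have "carrier G \<lhd> G" by (simp add: normal_inv_iff subgroup_self)
  from subgroup.one_closed[OF normal_invE(1)[OF lower_central_normal[OF this]]]
  have "lower_central G (carrier G) (d + 1) \<noteq> {}" by blast
  then have "lower_central (G Mod H) (carrier (G Mod H)) (d + 1) = {H}"
    using im one[OF carr] le by simp
  moreover have "lower_central (G Mod H) (carrier (G Mod H)) d \<noteq> {H}"
    using im one[OF carr] nle by simp
  ultimately show ?thesis
    using assms(1) Q.group_axioms by (auto simp: has_nilpotency_class_def nilpotent_group_def)
qed

lemma (in group) lower_central_subset_chain:
  fixes Z :: "nat \<Rightarrow> 'a set"
  assumes "Z 1 = H" "\<And>k. subgroup (Z (Suc k)) G"
    and "\<And>k x y. \<lbrakk>k \<ge> 1; x \<in> Z k; y \<in> H\<rbrakk> \<Longrightarrow> commutator G x y \<in> Z (Suc k)"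
    and "k \<ge> 1"
  shows "lower_central G H k \<subseteq> Z k"
  using assms(4)
proof (induction k rule: dec_induct)
  case (step k)
  have "comm_subgroup G (lower_central G H k) H \<subseteq> Z (Suc k)"
    using step assms(3) by (intro comm_subgroup_subset assms(2)) blast
  then show ?case using step by (simp add: lower_central_Suc)
qed (use assms(1) in simp)

text \<open>The subgroup attached to the sets of size \<open>n\<close> in \<open>Gamma G N d k\<close>.\<close>

definition mixed_comm :: "('a, 'b) monoid_scheme \<Rightarrow> 'a set \<Rightarrow> nat \<Rightarrow> nat \<Rightarrow> 'a set" where
  "mixed_comm G N k n = (if n < k then iter_comm G N n else lower_central G N n)"

section \<open>Commutator estimates for the mixed series\<close>

context group
begin

lemma mixed_comm_normal: "N \<lhd> G \<Longrightarrow> mixed_comm G N k n \<lhd> G"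
  by (simp add: mixed_comm_def iter_comm_normal lower_central_normal)

lemma mixed_comm_antimono:
  assumes "N \<lhd> G" "1 \<le> k" "k \<le> l"
  shows "mixed_comm G N l n \<subseteq> mixed_comm G N k n"
  using iter_comm_subset_lower_central[OF assms(1), of n] assms(2,3)
  by (auto simp: mixed_comm_def)

text \<open>The numbers a, b, c stand for the sizes of A, B and A \<union> B, which is where the
  three bounds on c come from. The target differs from \<open>mixed_comm G N k c\<close> only for c
  = k.\<close>

lemma commutator_mixed_comm:
  assumes N: "N \<lhd> G" and k: "k \<ge> 1"
    and x: "x \<in> mixed_comm G N k a" and y: "y \<in> mixed_comm G N 1 b"
    and c: "a \<le> c" "b \<le> c" "c \<le> a + b"
  shows "commutator G x y \<in> mixed_comm G N (Suc k) c"
proof -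
  have xc: "x \<in> carrier G" and yc: "y \<in> carrier G"
    using x y normal_invE(1)[OF mixed_comm_normal[OF N]] subgroup.subset by blast+
  consider (b0) "b = 0" "c = a" | (a0) "b \<ge> 1" "a = 0" "c = b" | (pos) "a \<ge> 1" "b \<ge> 1"
    using c by linarith
  then show ?thesis
  proof cases
    case b0
    show ?thesis
    \<comment> \<open>Raising k by one changes only the entry of size k. For other a normality
      suffices; for a = k, commuting y in G = [G,_0 N] with gamma_k(N) leads into [G,_k N].\<close>
    proof (cases "a = k")
      case True
      then have "x \<in> lower_central G N k" using x by (simp add: mixed_comm_def)
      then have "commutator G y x \<in> iter_comm G N k"
        using commutator_iter_comm_lower_central[OF N k, of y 0 x] yc by simp
      then have "commutator G x y \<in> iter_comm G N k"
        using normal.commutator_swap[OF iter_comm_normal[OF N] yc xc] by blast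
      then show ?thesis using True b0 by (simp add: mixed_comm_def)
    next
      case False
      then have "mixed_comm G N (Suc k) c = mixed_comm G N k a"
        using b0 by (auto simp: mixed_comm_def)
      then show ?thesis
        using normal_commutator_left[OF mixed_comm_normal[OF N] x yc] by simp
    qed
  next
    case a0
    \<comment> \<open>Since [G, gamma_b(N)] <= [G,_b N] <= gamma_b(N), the result fits whichever
      series governs size b.\<close>
    have "y \<in> lower_central G N b" using y a0 by (simp add: mixed_comm_def)
    then show ?thesis
      using commutator_iter_comm_lower_central[OF N, of b x 0 y] a0 xc
        iter_comm_subset_lower_central[OF N, of b]
      by (auto simp: mixed_comm_def)
  next
    case pos
    have yl: "y \<in> lower_central G N b" using y pos by (simp add: mixed_comm_def)
    have xl: "x \<in> lower_central G N a"
      using x pos iter_comm_subset_lower_central[OF N, of a]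
      by (auto simp: mixed_comm_def split: if_splits)
    have low: "commutator G x y \<in> lower_central G N (a + b)"
      using commutator_lower_central[OF N pos xl yl] .
    show ?thesis
    proof (cases "c \<le> k")
      case True
      have "commutator G x y \<in> iter_comm G N c"
      proof (cases "a < k")
        case True
        then have "commutator G x y \<in> iter_comm G N (a + b)"
          using commutator_iter_comm_lower_central[OF N pos(2) _ yl, of x a] x
          by (simp add: mixed_comm_def)
        then show ?thesis using iter_comm_antimono[OF N c(3)] by blast
      next
        case False
        \<comment> \<open>Now k <= a <= c <= k. Passing from gamma_{a+b}(N) to [G,_{a+b-1} N] loses
          one index, which b \<ge> 1 makes up for.\<close>
        then have "c = a" using True c by simp
        have "lower_central G N (a + b) \<subseteq> iter_comm G N (a + b - 1)"
          using lower_central_subset_iter_comm[of N "a + b - 1"] pos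
            subgroup.subset[OF normal_invE(1)[OF N]] by simp
        also have "\<dots> \<subseteq> iter_comm G N c"
          using iter_comm_antimono[OF N] \<open>c = a\<close> pos by simp
        finally show ?thesis using low by blast
      qed
      then show ?thesis using True by (simp add: mixed_comm_def)
    next
      case False
      then show ?thesis
        using low lower_central_antimono[OF N _ c(3)] c pos by (auto simp: mixed_comm_def)
    qed
  qed
qed

end
subsection \<open>Subgroups generated by normalised subsets\<close>

context group
begin

lemma commutator_consistent:
  assumes "subgroup H G" "x \<in> H" "y \<in> H"
  shows "commutator (G\<lparr>carrier := H\<rparr>) x y = commutator G x y"
  using assms by (simp add: commutator_def m_inv_consistent)

lemma comm_subgroup_consistent:
  assumes H: "subgroup H G" and "K \<subseteq> H" "L \<subseteq> H"
  shows "comm_subgroup (G\<lparr>carrier := H\<rparr>) K L = comm_subgroup G K L"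
proof -
  have "{commutator (G\<lparr>carrier := H\<rparr>) x y |x y. x \<in> K \<and> y \<in> L}
      = {commutator G x y |x y. x \<in> K \<and> y \<in> L}" (is "_ = ?X")
  proof -
    have "commutator (G\<lparr>carrier := H\<rparr>) x y = commutator G x y" if "x \<in> K" "y \<in> L" for x y
      using that assms commutator_consistent[OF H] by (simp add: subset_eq)
    then show ?thesis by (intro Collect_cong) metis
  qed
  moreover have "?X \<subseteq> H"
    using assms unfolding commutator_def
    by (auto intro!: subgroup.m_closed subgroup.m_inv_closed)
  ultimately show ?thesis
    using generate_consistent[OF _ H] by (simp add: comm_subgroup_def)
qed

text \<open>The nilpotency class refers to S as a group of its own, while commutators of
  \<open>Delta\<close> elements are computed in the cube; this lemma mediates between the
  two.\<close>

lemma lower_central_consistent: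
  assumes H: "subgroup H G" and K: "K \<subseteq> H"
  shows "lower_central (G\<lparr>carrier := H\<rparr>) K k = lower_central G K k"
proof (induction k rule: induct_nat_012)
  case (ge2 k)
  interpret H: group "G\<lparr>carrier := H\<rparr>" using subgroup_imp_group[OF H] .
  have "lower_central G K (Suc k) \<subseteq> H"
    using H.lower_central_subset_carrier[of K "Suc k"] K ge2 by simp
  then show ?case using comm_subgroup_consistent[OF H _ K] ge2 by simp
qed simp_all

lemma conj_generate:
  assumes S: "S \<subseteq> carrier G" and P: "subgroup P G" and g: "g \<in> carrier G"
    and gens: "\<And>x. x \<in> S \<Longrightarrow> g \<otimes> x \<otimes> inv g \<in> P" and "x \<in> generate G S"
  shows "g \<otimes> x \<otimes> inv g \<in> P"
  using assms(5)
proof (induction rule: generate.induct)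
  case one
  then show ?case using g P by (simp add: subgroup.one_closed)
next
  case (incl x)
  then show ?case by (rule gens)
next
  case (inv x)
  have "x \<in> carrier G" using inv S by blast
  then have "g \<otimes> inv x \<otimes> inv g = inv (g \<otimes> x \<otimes> inv g)"
    using g by (simp add: m_assoc inv_mult_group)
  then show ?case using gens[OF inv] P by (simp add: subgroup.m_inv_closed)
next
  case (eng x y)
  have "x \<in> carrier G" "y \<in> carrier G" using eng S generate_in_carrier by blast+
  then have "g \<otimes> (x \<otimes> y) \<otimes> inv g = (g \<otimes> x \<otimes> inv g) \<otimes> (g \<otimes> y \<otimes> inv g)"
    using g by (simp add: m_assoc inv_mult_cancel_left)
  then show ?case using eng P by (simp add: subgroup.m_closed)
qed

text \<open>K normalises the subgroup P generated by S, so KP is closed under products: k p l q = (k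
  l)(l^-1 p l) q.\<close>

lemma set_mult_generate:
  assumes K: "subgroup K G" and S: "S \<subseteq> carrier G"
    and conj: "\<And>k x. \<lbrakk>k \<in> K; x \<in> S\<rbrakk> \<Longrightarrow> k \<otimes> x \<otimes> inv k \<in> generate G S"
  shows "K <#> generate G S = generate G (K \<union> S)"
proof
  let ?P = "generate G S"
  have P: "subgroup ?P G" using generate_is_subgroup[OF S] .
  have Kc: "k \<in> carrier G" if "k \<in> K" for k using that subgroup.mem_carrier[OF K] by blast
  have Pc: "p \<in> carrier G" if "p \<in> ?P" for p using that generate_in_carrier[OF S] by blast
  have "K \<union> S \<subseteq> carrier G" using S Kc by blast
  then have U: "subgroup (generate G (K \<union> S)) G" by (rule generate_is_subgroup)
  have "K \<subseteq> generate G (K \<union> S)" by (auto intro: generate.incl)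
  moreover have "?P \<subseteq> generate G (K \<union> S)" by (rule mono_generate) blast
  ultimately show "K <#> ?P \<subseteq> generate G (K \<union> S)"
    using subgroup.m_closed[OF U] by (auto simp: set_mult_def subset_eq)
  have memI: "k \<otimes> p \<in> K <#> ?P" if "k \<in> K" "p \<in> ?P" for k p
    using that by (auto simp: set_mult_def)
  have memE: "\<exists>k\<in>K. \<exists>p\<in>?P. z = k \<otimes> p" if "z \<in> K <#> ?P" for z
    using that by (simp add: set_mult_def)
  have base: "z \<in> K <#> ?P" if "z \<in> K \<or> z \<in> ?P" for z
    using that memI[of z \<one>] memI[of \<one> z] Kc Pc
      subgroup.one_closed[OF K] subgroup.one_closed[OF P] by auto
  show "generate G (K \<union> S) \<subseteq> K <#> ?P"
  proof
    fix z assume "z \<in> generate G (K \<union> S)"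
    then show "z \<in> K <#> ?P"
    proof (induction rule: generate.induct)
      case one
      then show ?case using base subgroup.one_closed[OF K] by simp
    next
      case (incl z)
      then show ?case using base generate.incl[of z S G] by auto
    next
      case (inv z)
      then show ?case using base subgroup.m_inv_closed[OF K] generate.inv[of z S G] by auto
    next
      case (eng z w)
      obtain k p where z: "z = k \<otimes> p" "k \<in> K" "p \<in> ?P"
        using memE[OF eng.IH(1)] by blast
      obtain l q where w: "w = l \<otimes> q" "l \<in> K" "q \<in> ?P"
        using memE[OF eng.IH(2)] by blast
      note mem = z(2,3) w(2,3)
      have il: "inv l \<in> K" by (rule subgroup.m_inv_closed[OF K w(2)])
      have "inv l \<otimes> p \<otimes> inv (inv l) \<in> ?P"
        using conj_generate[OF S P Kc[OF il] conj[OF il] mem(2)] .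
      then have "inv l \<otimes> p \<otimes> l \<otimes> q \<in> ?P" using mem Kc subgroup.m_closed[OF P] by simp
      moreover have "z \<otimes> w = (k \<otimes> l) \<otimes> (inv l \<otimes> p \<otimes> l \<otimes> q)"
        using z w Kc Pc by (simp add: m_assoc inv_mult_cancel_left)
      ultimately show ?case using mem memI subgroup.m_closed[OF K] by simp
    qed
  qed
qed

text \<open>In an infinite group, t P t^-1 <= P does not give the same for t^-1; closing T under
  inverses covers both.\<close>

lemma generate_normal_in_generate:
  assumes S: "S \<subseteq> generate G T" and T: "T \<subseteq> carrier G"
    and inv: "\<And>t. t \<in> T \<Longrightarrow> inv t \<in> T"
    and conj: "\<And>t x. \<lbrakk>t \<in> T; x \<in> S\<rbrakk> \<Longrightarrow> t \<otimes> x \<otimes> inv t \<in> generate G S"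
  shows "generate G S \<lhd> G\<lparr>carrier := generate G T\<rparr>"
proof -
  let ?P = "generate G S"
  have T': "subgroup (generate G T) G" using generate_is_subgroup[OF T] .
  interpret T: group "G\<lparr>carrier := generate G T\<rparr>" using subgroup_imp_group[OF T'] .
  have Sc: "S \<subseteq> carrier G" using S T generate_incl by blast
  have P: "subgroup ?P G" using generate_is_subgroup[OF Sc] .
  have PT: "?P \<subseteq> generate G T" using generate_subgroup_incl[OF S T'] .
  have "t \<otimes> x \<otimes> inv t \<in> ?P" if "t \<in> generate G T" "x \<in> ?P" for t x
    using that
  proof (induction arbitrary: x rule: generate.induct)
    case one
    then show ?case using generate_in_carrier[OF Sc] by simp
  next
    case (incl t)
    then show ?case using conj_generate[OF Sc P] conj T by blast
  next
    case (inv t)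
    then show ?case using conj_generate[OF Sc P] conj T assms(3) by blast
  next
    case (eng s t)
    have "s \<in> carrier G" "t \<in> carrier G" "x \<in> carrier G"
      using eng generate_in_carrier[OF T] generate_in_carrier[OF Sc] by blast+
    then have "s \<otimes> t \<otimes> x \<otimes> inv (s \<otimes> t) = s \<otimes> (t \<otimes> x \<otimes> inv t) \<otimes> inv s"
      by (simp add: m_assoc inv_mult_group)
    then show ?case using eng by simp
  qed
  then show ?thesis
    using subgroup_incl[OF P T' PT] T' by (intro T.normal_invI) (simp_all add: m_inv_consistent)
qed

text \<open>M is normal only in H, so the argument on generators runs inside H as a group and is
  then read back in G.\<close>

lemma commutator_generate_in_subgroup:
  assumes H: "subgroup H G" and M: "M \<lhd> G\<lparr>carrier := H\<rparr>"
    and S: "S \<subseteq> H" and T: "T \<subseteq> H"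
    and gens: "\<And>x y. \<lbrakk>x \<in> S; y \<in> T\<rbrakk> \<Longrightarrow> commutator G x y \<in> M"
    and xy: "x \<in> generate G S" "y \<in> generate G T"
  shows "commutator G x y \<in> M"
proof -
  interpret M: normal M "G\<lparr>carrier := H\<rparr>" by (rule M)
  have "x \<in> H" "y \<in> H" using xy generate_subgroup_incl[OF _ H] S T by blast+
  moreover have "commutator (G\<lparr>carrier := H\<rparr>) x y \<in> M"
  proof (rule M.commutator_generate)
    show "x \<in> generate (G\<lparr>carrier := H\<rparr>) S" "y \<in> generate (G\<lparr>carrier := H\<rparr>) T"
      using xy by (simp_all add: generate_consistent[OF S H] generate_consistent[OF T H])
    fix s t assume st: "s \<in> S" "t \<in> T"
    then show "commutator (G\<lparr>carrier := H\<rparr>) s t \<in> M"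
      using gens[OF st] S T by (simp add: commutator_consistent[OF H] subset_iff)
  qed (use S T in simp_all)
  ultimately show ?thesis using commutator_consistent[OF H] by simp
qed

lemma set_prod_list_closed:
  "(\<And>Y. Y \<in> set Ys \<Longrightarrow> Y \<subseteq> carrier G) \<Longrightarrow> set_prod_list G Ys \<subseteq> carrier G"
  by (induction Ys) (simp_all add: set_prod_list_def setmult_subset_G)

lemma set_prod_list_append:
  assumes "\<And>Y. Y \<in> set (Ys @ Zs) \<Longrightarrow> Y \<subseteq> carrier G"
  shows "set_prod_list G (Ys @ Zs) = set_prod_list G Ys <#> set_prod_list G Zs"
  using assms
proof (induction Ys)
  case Nil
  then have "set_prod_list G Zs \<subseteq> carrier G" using set_prod_list_closed by simp
  then have "{\<one>} <#> set_prod_list G Zs = set_prod_list G Zs"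
    by (force simp: set_mult_def)
  then show ?case by (simp add: set_prod_list_def)
next
  case (Cons Y Ys)
  have Y: "Y \<subseteq> carrier G" using Cons.prems by simp
  have Ys: "set_prod_list G Ys \<subseteq> carrier G" and Zs: "set_prod_list G Zs \<subseteq> carrier G"
    using Cons.prems by (auto intro!: set_prod_list_closed)
  show ?case
    using Cons set_mult_assoc[OF Y Ys Zs] by (simp add: set_prod_list_def)
qed

end

subsection \<open>Subgroups of the cube\<close>

definition Delta_span ::
  "('a, 'b) monoid_scheme \<Rightarrow> nat \<Rightarrow> (nat set \<Rightarrow> 'a set) \<Rightarrow> nat set set \<Rightarrow> (nat set \<Rightarrow> 'a) set" where
  "Delta_span G d H U = generate (cube_group G d) (\<Union>A\<in>U. Delta G d A ` H A)"

context group
begin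

lemma group_cube_group: "group (cube_group G d)"
  by (simp add: is_group)

lemma group_hom_Delta: "group_hom G (cube_group G d) (Delta G d A)"
proof -
  interpret C: group "cube_group G d" by (rule group_cube_group)
  show ?thesis
    by unfold_locales (auto simp: hom_def Delta_def fun_eq_iff)
qed

lemma Delta_apply: "B \<in> Pow {1..d} \<Longrightarrow> Delta G d A u B = (if A \<subseteq> B then u else \<one>)"
  by (simp add: Delta_def)

lemma Delta_closed [simp]: "u \<in> carrier G \<Longrightarrow> Delta G d A u \<in> carrier (cube_group G d)"
  using group_hom.hom_closed[OF group_hom_Delta] .

lemma inv_Delta:
  "u \<in> carrier G \<Longrightarrow> inv\<^bsub>cube_group G d\<^esub> Delta G d A u = Delta G d A (inv u)"
  using group_hom.hom_inv[OF group_hom_Delta] by metis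

text \<open>At a coordinate containing both A and B, that is A \<union> B, the entries are u and v;
  at any other coordinate one entry is 1 and the commutator vanishes.\<close>

lemma commutator_Delta:
  assumes "u \<in> carrier G" "v \<in> carrier G"
  shows "commutator (cube_group G d) (Delta G d A u) (Delta G d B v)
    = Delta G d (A \<union> B) (commutator G u v)"
  unfolding commutator_def inv_Delta[OF assms(1)] inv_Delta[OF assms(2)]
  using assms by (auto simp: fun_eq_iff Delta_def)

text \<open>This is u v u^-1 = v [v,u^-1] in each coordinate: conjugation multiplies a generator by
  a commutator sitting at the union.\<close>

lemma conj_Delta:
  assumes "u \<in> carrier G" "v \<in> carrier G"
  shows "Delta G d A u \<otimes>\<^bsub>cube_group G d\<^esub> Delta G d B v
      \<otimes>\<^bsub>cube_group G d\<^esub> inv\<^bsub>cube_group G d\<^esub> Delta G d A u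
    = Delta G d B v \<otimes>\<^bsub>cube_group G d\<^esub> Delta G d (B \<union> A) (commutator G v (inv u))"
  unfolding inv_Delta[OF assms(1)]
  using assms by (auto simp: fun_eq_iff Delta_def word_simps)

lemma Delta_in_Delta_span:
  "\<lbrakk>A \<in> U; u \<in> H A\<rbrakk> \<Longrightarrow> Delta G d A u \<in> Delta_span G d H U"
  unfolding Delta_span_def by (rule generate.incl) blast

lemma Delta_span_generators_closed:
  assumes "\<And>A. A \<in> U \<Longrightarrow> H A \<subseteq> carrier G"
  shows "(\<Union>A\<in>U. Delta G d A ` H A) \<subseteq> carrier (cube_group G d)"
  using assms Delta_closed by blast

lemma subgroup_Delta_span:
  assumes "\<And>A. A \<in> U \<Longrightarrow> H A \<subseteq> carrier G"
  shows "subgroup (Delta_span G d H U) (cube_group G d)"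
  unfolding Delta_span_def
  by (intro group.generate_is_subgroup group_cube_group Delta_span_generators_closed assms)

text \<open>Collecting: the leading factor normalises the product of the later ones, because the
  commutators arising in \<open>conj_Delta\<close> sit at strictly larger sets, which come later.\<close>

lemma set_prod_list_Delta:
  assumes sorted: "sorted_wrt (\<lambda>A B. \<not> B \<subseteq> A) xs"
    and sub: "set xs \<subseteq> Pow {1..d}"
    and up: "\<And>A B. \<lbrakk>A \<in> set xs; B \<in> Pow {1..d}; A \<subseteq> B\<rbrakk> \<Longrightarrow> B \<in> set xs"
    and H: "\<And>A. A \<in> Pow {1..d} \<Longrightarrow> subgroup (H A) G"
    and comm: "\<And>A B u v. \<lbrakk>A \<in> Pow {1..d}; B \<in> Pow {1..d}; u \<in> H A; v \<in> H B\<rbrakk>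
      \<Longrightarrow> commutator G u v \<in> H (A \<union> B)"
  shows "set_prod_list (cube_group G d) (map (\<lambda>A. Delta G d A ` H A) xs)
    = Delta_span G d H (set xs)"
  using sorted sub up
proof (induction xs)
  case Nil
  show ?case
    using group.generate_empty[OF group_cube_group[of d]]
    by (simp add: set_prod_list_def Delta_span_def)
next
  case (Cons A xs)
  interpret C: group "cube_group G d" by (rule group_cube_group)
  let ?S = "\<Union>B\<in>set xs. Delta G d B ` H B"
  have A: "A \<in> Pow {1..d}" using Cons.prems by simp
  \<comment> \<open>Dropping the head keeps the list upward closed: a superset of B cannot be A,
    because B is not contained in A.\<close>
  have up: "C \<in> set xs" if "B \<in> set xs" "C \<in> Pow {1..d}" "B \<subseteq> C" for B C
  proof -
    have "C \<in> set (A # xs)" using Cons.prems(3)[of B C] that by simp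
    moreover have "\<not> B \<subseteq> A" using Cons.prems(1) that(1) by simp
    ultimately show ?thesis using that(3) by auto
  qed
  have Hc: "u \<in> carrier G" if "B \<in> Pow {1..d}" "u \<in> H B" for B u
    using subgroup.mem_carrier[OF H[OF that(1)] that(2)] .
  have sub: "H B \<subseteq> carrier G" if "B \<in> set xs" for B
  proof -
    have "B \<in> Pow {1..d}" using that Cons.prems(2) by auto
    then show ?thesis using Hc by blast
  qed
  have P: "subgroup (Delta_span G d H (set xs)) (cube_group G d)"
    using sub by (rule subgroup_Delta_span)
  have IH: "set_prod_list (cube_group G d) (map (\<lambda>A. Delta G d A ` H A) xs)
      = Delta_span G d H (set xs)"
    using Cons.IH Cons.prems up by simp
  have "Delta G d A ` H A <#>\<^bsub>cube_group G d\<^esub> generate (cube_group G d) ?S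
      = generate (cube_group G d) (Delta G d A ` H A \<union> ?S)"
  proof (rule C.set_mult_generate)
    show "subgroup (Delta G d A ` H A) (cube_group G d)"
      using group_hom.subgroup_img_is_subgroup[OF group_hom_Delta H[OF A]] .
    show "?S \<subseteq> carrier (cube_group G d)"
      using sub by (rule Delta_span_generators_closed)
    fix k x assume "k \<in> Delta G d A ` H A" "x \<in> ?S"
    then obtain u B v where k: "k = Delta G d A u" "u \<in> H A"
      and x: "x = Delta G d B v" "v \<in> H B" "B \<in> set xs" by blast
    have B: "B \<in> Pow {1..d}" using x Cons.prems(2) by auto
    have "B \<union> A \<in> set xs" using up[OF x(3), of "B \<union> A"] A B by auto
    moreover have "commutator G v (inv u) \<in> H (B \<union> A)"
      using comm[OF B A x(2)] subgroup.m_inv_closed[OF H[OF A] k(2)] .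
    ultimately have "Delta G d (B \<union> A) (commutator G v (inv u)) \<in> Delta_span G d H (set xs)"
      by (rule Delta_in_Delta_span)
    then have "k \<otimes>\<^bsub>cube_group G d\<^esub> x \<otimes>\<^bsub>cube_group G d\<^esub> inv\<^bsub>cube_group G d\<^esub> k
        \<in> Delta_span G d H (set xs)"
      unfolding k(1) x(1) conj_Delta[OF Hc[OF A k(2)] Hc[OF B x(2)]]
      by (rule subgroup.m_closed[OF P Delta_in_Delta_span[where U = "set xs" and H = H, OF x(3,2)]])
    then show "k \<otimes>\<^bsub>cube_group G d\<^esub> x \<otimes>\<^bsub>cube_group G d\<^esub> inv\<^bsub>cube_group G d\<^esub> k
        \<in> generate (cube_group G d) ?S"
      by (simp only: Delta_span_def)
  qed
  then show ?case
    using IH by (simp add: set_prod_list_def Delta_span_def)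
qed

lemma set_prod_list_Delta_apply_one:
  assumes "f \<in> set_prod_list (cube_group G d) (map (\<lambda>A. Delta G d A ` H A) xs)"
    and "B \<in> Pow {1..d}" "\<And>A. A \<in> set xs \<Longrightarrow> \<not> A \<subseteq> B"
  shows "f B = \<one>"
  using assms(1,3)
proof (induction xs arbitrary: f)
  case Nil
  then show ?case using assms(2) by (simp add: set_prod_list_def)
next
  case (Cons A xs)
  obtain u g where f: "f = Delta G d A u \<otimes>\<^bsub>cube_group G d\<^esub> g"
    and g: "g \<in> set_prod_list (cube_group G d) (map (\<lambda>A. Delta G d A ` H A) xs)"
    using Cons.prems(1) by (auto simp: set_prod_list_def set_mult_def)
  have "g B = \<one>" using Cons.IH[OF g] Cons.prems(2) by simp
  then show ?case
    using f assms(2) Cons.prems(2)[of A] by (simp add: Delta_apply)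
qed

text \<open>Peel off the head \<open>Delta G d A u\<close>. The later factors are trivial at A, so f
  A = u. If A is a proper subset of T, this forces u = 1; if A is not contained in T, the head is
  invisible at T and below. Only A = T contributes to f T.\<close>

lemma set_prod_list_Delta_apply_mem:
  assumes "f \<in> set_prod_list (cube_group G d) (map (\<lambda>A. Delta G d A ` H A) xs)"
    and sorted: "sorted_wrt (\<lambda>A B. \<not> B \<subseteq> A) xs"
    and sub: "set xs \<subseteq> Pow {1..d}"
    and H: "\<And>A. A \<in> Pow {1..d} \<Longrightarrow> subgroup (H A) G"
    and T: "T \<in> Pow {1..d}" and below: "\<And>B. B \<subset> T \<Longrightarrow> f B = \<one>"
  shows "f T \<in> H T"
  using assms(1) sorted sub below
proof (induction xs arbitrary: f)
  case Nil
  then show ?case using T subgroup.one_closed[OF H[OF T]] by (simp add: set_prod_list_def)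
next
  case (Cons A xs)
  let ?P = "set_prod_list (cube_group G d) (map (\<lambda>A. Delta G d A ` H A) xs)"
  obtain u g where f: "f = Delta G d A u \<otimes>\<^bsub>cube_group G d\<^esub> g" "u \<in> H A" and g: "g \<in> ?P"
    using Cons.prems(1) by (auto simp: set_prod_list_def set_mult_def)
  have A: "A \<in> Pow {1..d}" using Cons.prems by simp
  have uc: "u \<in> carrier G" using subgroup.mem_carrier[OF H[OF A] f(2)] .
  have "?P \<subseteq> carrier (cube_group G d)"
  proof (rule group.set_prod_list_closed[OF group_cube_group])
    fix Y assume "Y \<in> set (map (\<lambda>A. Delta G d A ` H A) xs)"
    then obtain B where B: "B \<in> set xs" "Y = Delta G d B ` H B" by auto
    then have "B \<in> Pow {1..d}" using Cons.prems(3) by auto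
    then show "Y \<subseteq> carrier (cube_group G d)"
      unfolding B(2) using Delta_closed subgroup.mem_carrier[OF H] by blast
  qed
  then have "g \<in> carrier (cube_group G d)" using g by blast
  then have gc: "g B \<in> carrier G" if "B \<in> Pow {1..d}" for B
    using that by (auto simp: PiE_iff)
  have fB: "f B = (if A \<subseteq> B then u else \<one>) \<otimes> g B" if "B \<in> Pow {1..d}" for B
    using f(1) that by (simp add: Delta_apply)
  have gA: "g A = \<one>"
    using set_prod_list_Delta_apply_one[OF g A] Cons.prems(2) by simp
  show ?case
  proof (cases "A = T")
    case True
    then show ?thesis using fB[OF T] gA f(2) uc by simp
  next
    case False
    have "f B = g B" if "B \<subseteq> T" for B
    proof (cases "A \<subseteq> B")
      case True
      then have "f A = \<one>" using Cons.prems(4) False that by blast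
      then have "u = \<one>" using fB[OF A] gA uc by simp
      then show ?thesis using fB[of B] gc[of B] that T by auto
    next
      case False
      then show ?thesis using fB[of B] gc[of B] that T by auto
    qed
    moreover have "g T \<in> H T"
      using Cons.IH[OF g] Cons.prems(2-4) calculation by (simp add: psubset_eq)
    ultimately show ?thesis by simp
  qed
qed

text \<open>By \<open>conj_Delta\<close>, \<open>comm\<close> is what conjugating generators
  requires. Each \<open>L A\<close> being a subgroup supplies the inverse closure asked for by
  \<open>generate_normal_in_generate\<close>.\<close>

lemma normal_Delta_span:
  assumes KL: "\<And>A. A \<in> U \<Longrightarrow> K A \<subseteq> L A"
    and L: "\<And>A. A \<in> U \<Longrightarrow> subgroup (L A) G"
    and U: "\<And>A B. \<lbrakk>A \<in> U; B \<in> U\<rbrakk> \<Longrightarrow> A \<union> B \<in> U"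
    and comm: "\<And>A B u v. \<lbrakk>A \<in> U; B \<in> U; u \<in> K A; v \<in> L B\<rbrakk> \<Longrightarrow> commutator G u v \<in> K (A \<union> B)"
  shows "Delta_span G d K U \<lhd> (cube_group G d)\<lparr>carrier := Delta_span G d L U\<rparr>"
proof -
  interpret C: group "cube_group G d" by (rule group_cube_group)
  have Lc: "v \<in> carrier G" if "B \<in> U" "v \<in> L B" for B v
    using subgroup.mem_carrier[OF L[OF that(1)] that(2)] .
  have Kc: "K A \<subseteq> carrier G" if "A \<in> U" for A using KL[OF that] Lc[OF that] by blast
  have P: "subgroup (Delta_span G d K U) (cube_group G d)"
    using Kc by (rule subgroup_Delta_span)
  show ?thesis
    unfolding Delta_span_def
  proof (rule C.generate_normal_in_generate)
    show "(\<Union>A\<in>U. Delta G d A ` L A) \<subseteq> carrier (cube_group G d)"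
      using L subgroup.subset by (intro Delta_span_generators_closed) auto
    show "(\<Union>A\<in>U. Delta G d A ` K A) \<subseteq> generate (cube_group G d) (\<Union>A\<in>U. Delta G d A ` L A)"
      using KL generate.incl[of _ "\<Union>A\<in>U. Delta G d A ` L A" "cube_group G d"] by blast
    fix t assume "t \<in> (\<Union>A\<in>U. Delta G d A ` L A)"
    then obtain B v where t: "t = Delta G d B v" "B \<in> U" "v \<in> L B" by blast
    have vc: "v \<in> carrier G" and iv: "inv v \<in> L B"
      using Lc[OF t(2,3)] subgroup.m_inv_closed[OF L[OF t(2)] t(3)] .
    show "inv\<^bsub>cube_group G d\<^esub> t \<in> (\<Union>A\<in>U. Delta G d A ` L A)"
      unfolding t(1) inv_Delta[OF vc] using t(2) iv by blast
    fix x assume "x \<in> (\<Union>A\<in>U. Delta G d A ` K A)"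
    then obtain A u where x: "x = Delta G d A u" "A \<in> U" "u \<in> K A" by blast
    have uc: "u \<in> carrier G" using x Kc by blast
    have "Delta G d (A \<union> B) (commutator G u (inv v)) \<in> Delta_span G d K U"
      using Delta_in_Delta_span[where U = U and H = K, OF U[OF x(2) t(2)] comm[OF x(2) t(2) x(3) iv]] .
    then show "t \<otimes>\<^bsub>cube_group G d\<^esub> x \<otimes>\<^bsub>cube_group G d\<^esub> inv\<^bsub>cube_group G d\<^esub> t
        \<in> generate (cube_group G d) (\<Union>A\<in>U. Delta G d A ` K A)"
      unfolding t(1) x(1) conj_Delta[OF vc uc] Delta_span_def [symmetric]
      by (rule subgroup.m_closed[OF P Delta_in_Delta_span[where U = U and H = K, OF x(2,3)]])
  qed
qed

text \<open>H, L and K will describe Gamma_k, Gamma_1 and Gamma_{k+1}. The condition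
  \<open>normal\<close> makes the K-span normal in the L-span, so commutators may be tested on
  generators, where \<open>comm\<close> applies.\<close>

lemma commutator_Delta_span:
  assumes HL: "\<And>A. A \<in> U \<Longrightarrow> H A \<subseteq> L A" and KL: "\<And>A. A \<in> U \<Longrightarrow> K A \<subseteq> L A"
    and L: "\<And>A. A \<in> U \<Longrightarrow> subgroup (L A) G"
    and U: "\<And>A B. \<lbrakk>A \<in> U; B \<in> U\<rbrakk> \<Longrightarrow> A \<union> B \<in> U"
    and normal: "\<And>A B u v. \<lbrakk>A \<in> U; B \<in> U; u \<in> K A; v \<in> L B\<rbrakk> \<Longrightarrow> commutator G u v \<in> K (A \<union> B)"
    and comm: "\<And>A B u v. \<lbrakk>A \<in> U; B \<in> U; u \<in> H A; v \<in> L B\<rbrakk> \<Longrightarrow> commutator G u v \<in> K (A \<union> B)"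
    and xy: "x \<in> Delta_span G d H U" "y \<in> Delta_span G d L U"
  shows "commutator (cube_group G d) x y \<in> Delta_span G d K U"
proof -
  interpret C: group "cube_group G d" by (rule group_cube_group)
  let ?X = "\<Union>A\<in>U. Delta G d A ` H A" and ?Y = "\<Union>A\<in>U. Delta G d A ` L A"
  have Lc: "v \<in> carrier G" if "B \<in> U" "v \<in> L B" for B v
    using subgroup.mem_carrier[OF L[OF that(1)] that(2)] .
  show ?thesis
  proof (rule C.commutator_generate_in_subgroup)
    show "subgroup (Delta_span G d L U) (cube_group G d)"
      using Lc by (intro subgroup_Delta_span) blast
    show "Delta_span G d K U \<lhd> (cube_group G d)\<lparr>carrier := Delta_span G d L U\<rparr>"
      by (rule normal_Delta_span) (fact KL L U normal)+
    show "?X \<subseteq> Delta_span G d L U" "?Y \<subseteq> Delta_span G d L U"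
      using HL Delta_in_Delta_span by blast+
    show "x \<in> generate (cube_group G d) ?X" "y \<in> generate (cube_group G d) ?Y"
      using xy by (simp_all only: Delta_span_def)
    fix s t assume "s \<in> ?X" "t \<in> ?Y"
    then obtain A u B v where st: "s = Delta G d A u" "A \<in> U" "u \<in> H A"
      "t = Delta G d B v" "B \<in> U" "v \<in> L B" by blast
    have "u \<in> carrier G" "v \<in> carrier G" using st HL[OF st(2)] Lc by blast+
    then show "commutator (cube_group G d) s t \<in> Delta_span G d K U"
      unfolding st(1,4) commutator_Delta[OF \<open>u \<in> carrier G\<close> \<open>v \<in> carrier G\<close>]
      by (intro Delta_in_Delta_span[where U = U and H = K] U comm st)
  qed
qed

end

section \<open>Short-lex order and reindexing of the cube\<close>

lemma filter_less_append_filter_ge: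
  fixes f :: "'c \<Rightarrow> nat"
  assumes "sorted_wrt (\<lambda>x y. f x \<le> f y) xs"
  shows "filter (\<lambda>x. f x < k) xs @ filter (\<lambda>x. f x \<ge> k) xs = xs"
  using assms
proof (induction xs)
  case (Cons x xs)
  show ?case
  proof (cases "f x < k")
    case False
    then have "\<forall>y\<in>set xs. f y \<ge> k" using Cons.prems by force
    then have "filter (\<lambda>y. f y < k) xs = []" "filter (\<lambda>y. f y \<ge> k) xs = xs"
      by (auto simp: filter_empty_conv filter_id_conv)
    then show ?thesis using False by simp
  qed (use Cons in simp)
qed simp

lemma shortlex_list_sorted_card: "sorted_wrt (\<lambda>A B. card A \<le> card B) (shortlex_list d)"
  using shortlex_list_props(3)[of d]
  by (rule sorted_wrt_mono_rel[rotated]) (auto simp: shortlex_def)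

text \<open>Short-lex refines inclusion, since a proper subset is smaller and so comes earlier. In
  this form the order enters both collecting and the reading of coordinates.\<close>

lemma shortlex_list_sorted_not_subset: "sorted_wrt (\<lambda>A B. \<not> B \<subseteq> A) (shortlex_list d)"
proof (rule sorted_wrt_mono_rel[OF _ shortlex_list_props(3)])
  fix A B assume AB: "A \<in> set (shortlex_list d)" "shortlex A B"
  then have "finite A" using shortlex_list_props(1) finite_subset[of A "{1..d}"] by auto
  show "\<not> B \<subseteq> A"
  proof
    assume "B \<subseteq> A"
    then have "card B \<le> card A" using \<open>finite A\<close> card_mono by blast
    then have "card A = card B" using AB(2) by (auto simp: shortlex_def)
    then have "A = B" using \<open>B \<subseteq> A\<close> \<open>finite A\<close> card_subset_eq by metis
    then show False using AB(2) shortlex_irrefl by blast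
  qed
qed

lemma product_group_reindex_iso:
  assumes G: "group G" and h: "bij_betw h J I"
  shows "product_group I (\<lambda>_. G) \<cong> product_group J (\<lambda>_. G)"
proof -
  let ?\<phi> = "\<lambda>f. \<lambda>j\<in>J. f (h j)"
  let ?\<psi> = "\<lambda>f. \<lambda>i\<in>I. f (inv_into J h i)"
  have hJ: "h j \<in> I" if "j \<in> J" for j using that h bij_betwE by metis
  have iI: "inv_into J h i \<in> J" "h (inv_into J h i) = i" if "i \<in> I" for i
    using that h by (metis bij_betw_imp_surj_on inv_into_into, metis bij_betw_inv_into_right)
  have ih: "inv_into J h (h j) = j" if "j \<in> J" for j
    using that h by (metis bij_betw_inv_into_left)
  have "?\<phi> \<in> hom (product_group I (\<lambda>_. G)) (product_group J (\<lambda>_. G))"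
    using hJ by (auto simp: hom_def fun_eq_iff)
  moreover have "bij_betw ?\<phi> (carrier (product_group I (\<lambda>_. G))) (carrier (product_group J (\<lambda>_. G)))"
    by (rule bij_betw_byWitness[where f' = ?\<psi>])
      (use hJ iI ih in \<open>auto simp: PiE_iff fun_eq_iff extensional_def\<close>)
  ultimately show ?thesis by (auto simp: is_iso_def iso_def)
qed

section \<open>The subgroups Gamma_k of the cube\<close>

context group
begin

text \<open>Short-lex compares sizes first, so the sets of size below k form an initial segment and
  the two products in \<open>Gamma_def\<close> concatenate.\<close>

lemma Gamma_eq_set_prod_list:
  assumes N: "N \<lhd> G"
  shows "Gamma G N d k = set_prod_list (cube_group G d)
    (map (\<lambda>A. Delta G d A ` mixed_comm G N k (card A)) (shortlex_list d))"
proof -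
  interpret C: group "cube_group G d" by (rule group_cube_group)
  let ?xs = "shortlex_list d" and ?D = "\<lambda>A. Delta G d A ` mixed_comm G N k (card A)"
  let ?lo = "filter (\<lambda>A. card A < k) ?xs" and ?hi = "filter (\<lambda>A. card A \<ge> k) ?xs"
  have "mixed_comm G N k n \<subseteq> carrier G" for n
    using normal_invE(1)[OF mixed_comm_normal[OF N]] by (rule subgroup.subset)
  then have "?D A \<subseteq> carrier (cube_group G d)" for A
    using Delta_closed by blast
  then have "set_prod_list (cube_group G d) (map ?D ?lo @ map ?D ?hi)
      = set_prod_list (cube_group G d) (map ?D ?lo)
        <#>\<^bsub>cube_group G d\<^esub> set_prod_list (cube_group G d) (map ?D ?hi)"
    by (intro C.set_prod_list_append) auto
  moreover have "map ?D ?lo @ map ?D ?hi = map ?D ?xs"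
    using filter_less_append_filter_ge[OF shortlex_list_sorted_card] by (metis map_append)
  moreover have "map (\<lambda>A. Delta G d A ` iter_comm G N (card A)) ?lo = map ?D ?lo"
    "map (\<lambda>A. Delta G d A ` lower_central G N (card A)) ?hi = map ?D ?hi"
    by (auto simp: mixed_comm_def)
  ultimately show ?thesis by (simp only: Gamma_def)
qed

lemma commutator_mixed_comm_card:
  fixes d :: nat
  assumes N: "N \<lhd> G" and k: "k \<ge> 1" and A: "A \<in> Pow {1..d}" and B: "B \<in> Pow {1..d}"
    and "u \<in> mixed_comm G N k (card A)" "v \<in> mixed_comm G N 1 (card B)"
  shows "commutator G u v \<in> mixed_comm G N (Suc k) (card (A \<union> B))"
proof -
  have "finite A" "finite B" using A B finite_subset[of _ "{1..d}"] by auto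
  then show ?thesis
    using assms card_mono[of "A \<union> B"] card_Un_le[of A B]
    by (intro commutator_mixed_comm[of N k u "card A" v "card B"]) auto
qed

lemma mixed_comm_Suc_subset:
  "\<lbrakk>N \<lhd> G; k \<ge> 1\<rbrakk> \<Longrightarrow> mixed_comm G N (Suc k) n \<subseteq> mixed_comm G N k n"
  by (rule mixed_comm_antimono) auto

lemma Gamma_eq_Delta_span:
  assumes N: "N \<lhd> G" and k: "k \<ge> 1"
  shows "Gamma G N d k = Delta_span G d (\<lambda>A. mixed_comm G N k (card A)) (Pow {1..d})"
proof -
  have "set_prod_list (cube_group G d)
      (map (\<lambda>A. Delta G d A ` mixed_comm G N k (card A)) (shortlex_list d))
    = Delta_span G d (\<lambda>A. mixed_comm G N k (card A)) (set (shortlex_list d))"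
  proof (rule set_prod_list_Delta[OF shortlex_list_sorted_not_subset])
    fix A B u v
    assume "A \<in> Pow {1..d}" "B \<in> Pow {1..d}"
      "u \<in> mixed_comm G N k (card A)" "v \<in> mixed_comm G N k (card B)"
    \<comment> \<open>The second factor is enlarged from \<open>mixed_comm G N k\<close> to
      \<open>mixed_comm G N 1\<close>; the gain from k to \<open>Suc k\<close> is given up again
      afterwards.\<close>
    then have "commutator G u v \<in> mixed_comm G N (Suc k) (card (A \<union> B))"
      using commutator_mixed_comm_card[OF N k] mixed_comm_antimono[OF N _ k] by blast
    then show "commutator G u v \<in> mixed_comm G N k (card (A \<union> B))"
      using mixed_comm_Suc_subset[OF N k] by blast
  qed (simp_all only: shortlex_list_props(1) normal_invE(1)[OF mixed_comm_normal[OF N]] order_refl)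
  then show ?thesis
    unfolding Gamma_eq_set_prod_list[OF N] shortlex_list_props(1) .
qed

lemma subgroup_Gamma:
  assumes N: "N \<lhd> G" and k: "k \<ge> 1"
  shows "subgroup (Gamma G N d k) (cube_group G d)"
  unfolding Gamma_eq_Delta_span[OF assms]
  by (intro subgroup_Delta_span subgroup.subset normal_invE(1) mixed_comm_normal N)

lemma Delta_in_Gamma:
  assumes N: "N \<lhd> G" and k: "k \<ge> 1"
    and "A \<in> Pow {1..d}" "u \<in> mixed_comm G N k (card A)"
  shows "Delta G d A u \<in> Gamma G N d k"
  unfolding Gamma_eq_Delta_span[OF N k]
  using assms(3,4) by (rule Delta_in_Delta_span)

lemma Gamma_normal:
  assumes N: "N \<lhd> G" and k: "k \<ge> 1"
  shows "Gamma G N d k \<lhd> (cube_group G d)\<lparr>carrier := Gamma G N d 1\<rparr>"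
  unfolding Gamma_eq_Delta_span[OF N k] Gamma_eq_Delta_span[OF N order_refl]
proof (rule normal_Delta_span)
  fix A B u v
  assume "A \<in> Pow {1..d}" "B \<in> Pow {1..d}"
    "u \<in> mixed_comm G N k (card A)" "v \<in> mixed_comm G N 1 (card B)"
  then show "commutator G u v \<in> mixed_comm G N k (card (A \<union> B))"
    using commutator_mixed_comm_card[OF N k] mixed_comm_Suc_subset[OF N k] by blast
qed (use mixed_comm_antimono[OF N _ k] normal_invE(1)[OF mixed_comm_normal[OF N]] in auto)

lemma commutator_Gamma:
  assumes N: "N \<lhd> G" and k: "k \<ge> 1"
    and xy: "x \<in> Gamma G N d k" "y \<in> Gamma G N d 1"
  shows "commutator (cube_group G d) x y \<in> Gamma G N d (Suc k)"
proof -
  have Sk: "Suc k \<ge> 1" by simp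
  show ?thesis
    unfolding Gamma_eq_Delta_span[OF N Sk]
  proof (rule commutator_Delta_span)
    show "x \<in> Delta_span G d (\<lambda>A. mixed_comm G N k (card A)) (Pow {1..d})"
      "y \<in> Delta_span G d (\<lambda>A. mixed_comm G N 1 (card A)) (Pow {1..d})"
      using xy unfolding Gamma_eq_Delta_span[OF N k] Gamma_eq_Delta_span[OF N order_refl] .
    fix A B u v
    assume AB: "A \<in> Pow {1..d}" "B \<in> Pow {1..d}" "v \<in> mixed_comm G N 1 (card B)"
    show "commutator G u v \<in> mixed_comm G N (Suc k) (card (A \<union> B))"
      if "u \<in> mixed_comm G N k (card A)"
      using commutator_mixed_comm_card[OF N k AB(1,2) that AB(3)] .
    show "commutator G u v \<in> mixed_comm G N (Suc k) (card (A \<union> B))"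
      if "u \<in> mixed_comm G N (Suc k) (card A)"
      using commutator_mixed_comm_card[OF N k AB(1,2) _ AB(3)] mixed_comm_Suc_subset[OF N k] that
      by blast
  qed (use mixed_comm_antimono[OF N _ k] mixed_comm_antimono[OF N _ Sk]
      normal_invE(1)[OF mixed_comm_normal[OF N]] in auto)
qed

lemma lower_central_Gamma_subset:
  assumes N: "N \<lhd> G" and k: "k \<ge> 1"
  shows "lower_central (cube_group G d) (Gamma G N d 1) k \<subseteq> Gamma G N d k"
  by (rule group.lower_central_subset_chain[OF group_cube_group])
    (use k subgroup_Gamma[OF N] commutator_Gamma[OF N] in auto)

text \<open>\<open>lower_central_normal\<close> needs a normal subgroup of the ambient group, so it
  is applied inside H, where H is normal.\<close>

lemma subgroup_lower_central:
  assumes H: "subgroup H G"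
  shows "subgroup (lower_central G H k) G"
proof -
  interpret H: group "G\<lparr>carrier := H\<rparr>" using subgroup_imp_group[OF H] .
  have "H \<lhd> G\<lparr>carrier := H\<rparr>"
    using H.normal_inv_iff H.subgroup_self H.m_closed H.inv_closed by auto
  then have "lower_central G H k \<lhd> G\<lparr>carrier := H\<rparr>"
    using H.lower_central_normal lower_central_consistent[OF H order_refl] by metis
  then show ?thesis using H.normal_invE(1) incl_subgroup[OF H] by blast
qed

text \<open>Each commutator with an element at the singleton {k+1} enlarges {1..k} by one point.
  These elements lie in S because sets of size 1 carry gamma_1(N) = N in Gamma_1.\<close>

lemma Delta_lower_central:
  assumes N: "N \<lhd> G" and "1 \<le> k" "k \<le> d"
  shows "Delta G d {1..k} ` lower_central G N k
    \<subseteq> lower_central (cube_group G d) (Gamma G N d 1) k"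
  using assms(2,3)
proof (induction k rule: dec_induct)
  case base
  then show ?case
    using Delta_in_Gamma[OF N order_refl, of "{1..1}" d] by (auto simp: mixed_comm_def)
next
  case (step k)
  let ?C = "cube_group G d" and ?S = "Gamma G N d 1"
  interpret C: group ?C by (rule group_cube_group)
  let ?X = "{commutator G u v |u v. u \<in> lower_central G N k \<and> v \<in> N}"
  have Nc: "v \<in> carrier G" if "v \<in> N" for v
    using that normal_invE(1)[OF N] subgroup.mem_carrier by metis
  have lc: "u \<in> carrier G" if "u \<in> lower_central G N k" for u
    using that normal_invE(1)[OF lower_central_normal[OF N]] subgroup.mem_carrier by metis
  have Suc: "{1..k} \<union> {Suc k} = {1..Suc k}" by auto
  have "Delta G d {1..Suc k} (commutator G u v) \<in> lower_central ?C ?S (Suc k)"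
    if "u \<in> lower_central G N k" "v \<in> N" for u v
  proof -
    have "Delta G d {Suc k} v \<in> ?S"
      using Delta_in_Gamma[OF N order_refl, of "{Suc k}" d v] that step.prems
      by (simp add: mixed_comm_def)
    moreover have "Delta G d {1..k} u \<in> lower_central ?C ?S k" using step that by auto
    ultimately have "commutator ?C (Delta G d {1..k} u) (Delta G d {Suc k} v)
        \<in> lower_central ?C ?S (Suc k)"
      unfolding C.lower_central_Suc[OF step.hyps(1)] by (intro C.commutator_in_comm_subgroup)
    then show ?thesis
      using commutator_Delta[OF lc[OF that(1)] Nc[OF that(2)], of d "{1..k}" "{Suc k}"] Suc by simp
  qed
  \<comment> \<open>\<open>Delta\<close> is a homomorphism in its last argument, so the inclusion
    passes from commutators to the subgroup they generate.\<close>
  then have "Delta G d {1..Suc k} ` ?X \<subseteq> lower_central ?C ?S (Suc k)" by blast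
  then have "generate ?C (Delta G d {1..Suc k} ` ?X) \<subseteq> lower_central ?C ?S (Suc k)"
    by (rule C.generate_subgroup_incl)
      (rule C.subgroup_lower_central[OF subgroup_Gamma[OF N order_refl]])
  moreover have "?X \<subseteq> carrier G" using Nc lc commutator_closed by blast
  ultimately show ?case
    using group_hom.generate_img[OF group_hom_Delta, of ?X d "{1..Suc k}"] step.hyps
    by (simp add: lower_central_Suc comm_subgroup_def)
qed

text \<open>For k = d + 1 even the full set has size below k, so its factor is [G,_d N]. The element
  is trivial at all proper subsets, and \<open>set_prod_list_Delta_apply_mem\<close> reads off the
  top coordinate.\<close>

lemma Delta_top_in_Gamma_top:
  assumes N: "N \<lhd> G" and "Delta G d {1..d} u \<in> Gamma G N d (d + 1)"
  shows "u \<in> iter_comm G N d"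
proof -
  have "Delta G d {1..d} u {1..d} \<in> mixed_comm G N (d + 1) (card {1..d})"
  proof (rule set_prod_list_Delta_apply_mem[where d = d and xs = "shortlex_list d"
        and f = "Delta G d {1..d} u" and T = "{1..d}"])
    show "Delta G d {1..d} u \<in> set_prod_list (cube_group G d)
        (map (\<lambda>A. Delta G d A ` mixed_comm G N (d + 1) (card A)) (shortlex_list d))"
      using assms(2) unfolding Gamma_eq_set_prod_list[OF N] .
    show "Delta G d {1..d} u B = \<one>" if "B \<subset> {1..d}" for B
      using that Delta_apply[of B d "{1..d}" u] by auto
  qed (simp_all only: shortlex_list_sorted_not_subset shortlex_list_props(1) order_refl
      normal_invE(1)[OF mixed_comm_normal[OF N]] Pow_top)
  then show ?thesis by (simp add: Delta_apply mixed_comm_def)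
qed

text \<open>\<open>Delta\<close> at the empty set is the constant tuple and the factor there is
  [G,_0 N] = G, so S contains the diagonal.\<close>

lemma subdirect_Gamma:
  assumes N: "N \<lhd> G"
  shows "subdirect (Pow {1..d}) (\<lambda>_. G) (Gamma G N d 1)"
  unfolding subdirect_def
proof (intro conjI ballI subgroup_Gamma[OF N order_refl])
  fix B assume B: "B \<in> Pow {1..d}"
  have "Gamma G N d 1 \<subseteq> carrier (cube_group G d)"
    using subgroup_Gamma[OF N order_refl] by (rule subgroup.subset)
  then have "(\<lambda>f. f B) ` Gamma G N d 1 \<subseteq> carrier G"
    using B by (fastforce simp: PiE_iff)
  moreover have "u \<in> (\<lambda>f. f B) ` Gamma G N d 1" if "u \<in> carrier G" for u
  proof (rule image_eqI)
    show "u = Delta G d {} u B" using Delta_apply[OF B, of "{}" u] by simp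
    show "Delta G d {} u \<in> Gamma G N d 1"
      using Delta_in_Gamma[OF N order_refl, of "{}" d u] that by (simp add: mixed_comm_def)
  qed
  ultimately show "(\<lambda>f. f B) ` Gamma G N d 1 = carrier G" by blast
qed

end

theorem theorem4p2:
  fixes G :: "('a, 'b) monoid_scheme" (structure) and N :: "'a set" and d :: nat
  assumes "perfect_group G"
    and "d \<ge> 1"
    and "N \<lhd> G"
    and "iter_comm G N d \<subset> lower_central G N d"
  shows "subdirect (Pow {1..d}) (\<lambda>_. G) (Gamma G N d 1)
    \<and> cube_group G d \<cong> product_group {..<2 ^ d :: nat} (\<lambda>_. G)
    \<and> (\<exists>M. M \<lhd> (cube_group G d)\<lparr>carrier := Gamma G N d 1\<rparr>
           \<and> has_nilpotency_class ((cube_group G d)\<lparr>carrier := Gamma G N d 1\<rparr> Mod M) d)"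
proof -
  interpret group G using assms(1) by (simp add: perfect_group_def)
  interpret C: group "cube_group G d" by (rule group_cube_group)
  note N = \<open>N \<lhd> G\<close>
  let ?S = "Gamma G N d 1" and ?M = "Gamma G N d (d + 1)"
  let ?T = "(cube_group G d)\<lparr>carrier := ?S\<rparr>"
  have "bij_betw (from_nat_into (Pow {1..d})) {..<2 ^ d} (Pow {1..d})"
    using bij_betw_from_nat_into_finite[of "Pow {1..d}"] by (simp add: card_Pow)
  then have iso: "cube_group G d \<cong> product_group {..<2 ^ d :: nat} (\<lambda>_. G)"
    by (rule product_group_reindex_iso[OF is_group])
  have M: "?M \<lhd> ?T" by (rule Gamma_normal[OF N]) simp
  have T: "lower_central ?T (carrier ?T) k = lower_central (cube_group G d) ?S k" for k
    using C.lower_central_consistent[OF subgroup_Gamma[OF N order_refl] order_refl] by simp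
  have "lower_central ?T (carrier ?T) (d + 1) \<subseteq> ?M"
    unfolding T by (rule lower_central_Gamma_subset[OF N]) simp
  moreover have "\<not> lower_central ?T (carrier ?T) d \<subseteq> ?M"
  proof -
    obtain u where u: "u \<in> lower_central G N d" "u \<notin> iter_comm G N d" using assms(4) by blast
    have "Delta G d {1..d} u \<in> lower_central ?T (carrier ?T) d"
      unfolding T using Delta_lower_central[OF N assms(2) order_refl] u(1) by blast
    moreover have "Delta G d {1..d} u \<notin> ?M" using Delta_top_in_Gamma_top[OF N] u(2) by blast
    ultimately show ?thesis by blast
  qed
  ultimately have "has_nilpotency_class (?T Mod ?M) d"
    by (rule normal.has_nilpotency_class_Mod[OF M assms(2)])
  then show ?thesis using subdirect_Gamma[OF N] iso M by blast
qed

end
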